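(* Let $(A,\mathbf{B})$ be a noncommutative reality-based algebra of rank $6$ such that $\mathbf{B}$ is an RBA$^{\delta}$-basis. Then the real algebra $\mathbb{R}\mathbf{B}$ (the $\mathbb{R}$-span of $\mathbf{B}$) is isomorphic to $\mathbb{R}\oplus\mathbb{R}\oplus M_2(\mathbb{R})$ and, up to a change of basis, the involution $*$ acts on the component $M_2(\mathbb{R})$ as matrix transposition. In particular, $\mathbf{B}$ has exactly four $*$-invariant elements.
   Context: An algebra with involution is a $\mathbb{C}$-algebra $A$ with a conjugate-semilinear involution $*$ satisfying $(\alpha x)^*=\bar\alpha x^*$ and $(xy)^*=y^*x^*$. A reality-based algebra (RBA) $(A,\mathbf{B})$ of rank $r$ is a finite-dimensional algebra with involution $A$ over $\mathbb{C}$ with a distinguished basis $\mathbf{B}=\{b_0,\dots,b_{r-1}\}$ such that: (1) $b_0=1_A$; (2) the structure constants $\lambda_{ijk}$ in $b_ib_j=\sum_k\lambda_{ijk}b_k$ are real; (3) $\mathbf{B}^*=\mathbf{B}$, and one writes $b_{i^*}=(b_i)^*$; (4) $\lambda_{ij0}\neq 0$ if and only if $j=i^*$; (5) $\lambda_{ii^*0}=\lambda_{i^*i0}>0$ for all $i$. The RBA is noncommutative if $A$ is. A positive degree map is a one-dimensional algebra homomorphism $\delta:A\to\mathbb{C}$ with $\delta(a^* )=\overline{\delta(a)}$ for all $a\in A$ and $\delta(b_i)>0$ for all $b_i\in\mathbf{B}$. If $(A,\mathbf{B})$ has a positive degree map $\delta$, then $\mathbf{B}$ is called an RBA$^{\delta}$-basis.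 *)

theory Defs
  imports "HOL-Analysis.Analysis" "HOL-Library.Complex_Order"
begin

text \<open>
  The algebra \<open>A\<close> is the whole type \<open>'a\<close>; \<open>smul\<close> is its complex scalar multiplication.
\<close>

locale complex_algebra = vector_space smul
  for smul :: "complex \<Rightarrow> 'a::ring_1 \<Rightarrow> 'a"  (infixr \<open>*\<^sub>A\<close> 75) +
  assumes scale_mult_left: "(c *\<^sub>A x) * y = c *\<^sub>A (x * y)"
    and scale_mult_right: "x * (c *\<^sub>A y) = c *\<^sub>A (x * y)"

locale involution_algebra = complex_algebra smul
  for smul :: "complex \<Rightarrow> 'a::ring_1 \<Rightarrow> 'a"  (infixr \<open>*\<^sub>A\<close> 75) +
  fixes star :: "'a \<Rightarrow> 'a"
  assumes star_add: "star (x + y) = star x + star y"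
    and star_scale: "star (c *\<^sub>A x) = cnj c *\<^sub>A star x"
    and star_mult: "star (x * y) = star y * star x"
    and star_star: "star (star x) = x"

text \<open>
  The basis is a finite set \<open>B\<close> rather than an indexed family, with \<open>b\<^sub>0 = 1\<close>; the rank is
  \<open>card B\<close>. The term \<open>representation B (x * y) z\<close> is the coefficient of \<open>z\<close> in \<open>x * y\<close>, that is,
  the structure constant \<open>\<lambda>\<^sub>i\<^sub>j\<^sub>k\<close> for \<open>x = b\<^sub>i\<close>, \<open>y = b\<^sub>j\<close>, \<open>z = b\<^sub>k\<close>. In the order on the complex
  numbers used here, \<open>0 < c\<close> means that \<open>c\<close> is real and positive.
\<close>

locale reality_based_algebra = involution_algebra smul star
  for smul :: "complex \<Rightarrow> 'a::ring_1 \<Rightarrow> 'a"  (infixr \<open>*\<^sub>A\<close> 75)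
    and star :: "'a \<Rightarrow> 'a" +
  fixes B :: "'a set"
  assumes finite_basis: "finite B"
    and independent_basis: "independent B"
    and span_basis: "span B = UNIV"
    and one_in_basis: "1 \<in> B"
    and structure_constants_real:
      "\<lbrakk>x \<in> B; y \<in> B; z \<in> B\<rbrakk> \<Longrightarrow> representation B (x * y) z \<in> \<real>"
    and star_basis: "star ` B = B"
    and coeff_one_nonzero_iff:
      "\<lbrakk>x \<in> B; y \<in> B\<rbrakk> \<Longrightarrow> representation B (x * y) 1 \<noteq> 0 \<longleftrightarrow> y = star x"
    and coeff_one_star_commute:
      "x \<in> B \<Longrightarrow> representation B (x * star x) 1 = representation B (star x * x) 1"
    and coeff_one_star_pos:
      "x \<in> B \<Longrightarrow> 0 < representation B (x * star x) 1"

definition positive_degree_map ::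
  "(complex \<Rightarrow> 'a::ring_1 \<Rightarrow> 'a) \<Rightarrow> ('a \<Rightarrow> 'a) \<Rightarrow> 'a set \<Rightarrow> ('a \<Rightarrow> complex) \<Rightarrow> bool"
  where "positive_degree_map smul star B \<delta> \<longleftrightarrow>
    Vector_Spaces.linear smul (*) \<delta> \<and>
    \<delta> 1 = 1 \<and> (\<forall>x y. \<delta> (x * y) = \<delta> x * \<delta> y) \<and>
    (\<forall>x. \<delta> (star x) = cnj (\<delta> x)) \<and>
    (\<forall>b\<in>B. 0 < \<delta> b)"

definition real_scale :: "(complex \<Rightarrow> 'a \<Rightarrow> 'a) \<Rightarrow> real \<Rightarrow> 'a::ring_1 \<Rightarrow> 'a"
  where "real_scale smul r x = smul (complex_of_real r) x"

definition real_span :: "(complex \<Rightarrow> 'a \<Rightarrow> 'a) \<Rightarrow> 'a set \<Rightarrow> 'a::ring_1 set"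
  where "real_span smul B = module.span (real_scale smul) B"

lemma (in complex_algebra) vector_space_real_scale: "vector_space (real_scale smul)"
  by unfold_locales
    (simp_all add: real_scale_def scale_right_distrib scale_left_distrib)

text \<open>
  The algebra \<open>\<real> \<oplus> \<real> \<oplus> M\<^sub>2(\<real>)\<close>. Its addition and real scaling are those of the product type; its
  multiplication has to be defined, because \<open>*\<close> on the type of matrices is entrywise.
\<close>

type_synonym RRM2 = "real \<times> real \<times> (real^2^2)"

definition RRM2_one :: RRM2
  where "RRM2_one = (1, 1, mat 1)"

definition RRM2_mult :: "RRM2 \<Rightarrow> RRM2 \<Rightarrow> RRM2"
  where "RRM2_mult = (\<lambda>(a, b, M) (c, d, N). (a * c, b * d, M ** N))"

definition RRM2_iso :: "(complex \<Rightarrow> 'a::ring_1 \<Rightarrow> 'a) \<Rightarrow> 'a set \<Rightarrow> (RRM2 \<Rightarrow> 'a) \<Rightarrow> bool"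
  where "RRM2_iso smul R \<psi> \<longleftrightarrow>
    bij_betw \<psi> UNIV R \<and>
    Vector_Spaces.linear scaleR (real_scale smul) \<psi> \<and>
    \<psi> RRM2_one = 1 \<and> (\<forall>u v. \<psi> (RRM2_mult u v) = \<psi> u * \<psi> v)"

end

theory Submission
  imports Defs
begin

text \<open>
  The coefficient of \<open>1\<close> is a trace \<open>t\<close> for which \<open>t (x * star x)\<close> is positive definite, and \<open>\<delta>\<close>
  yields a central idempotent \<open>e\<close> of the real span \<open>R\<close> with \<open>R * e = \<real> e\<close>. Skew elements are killed by
  \<open>e\<close>. Let \<open>S\<close> and \<open>K\<close> be the spaces of symmetric and skew elements; \<open>dim K\<close> is half the number of
  basis elements that \<open>star\<close> moves, so it is 0, 1 or 2.

  If \<open>K = 0\<close> then \<open>R\<close> is commutative. If \<open>dim K = 2\<close>, commutators of skew elements are orthogonal to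
  \<open>K\<close>, so \<open>K\<close> is commutative, and \<open>1\<close>, \<open>e\<close> and some product \<open>z\<close> of skew elements are independent and
  commute with \<open>K\<close>. A nonzero commutator \<open>[k, a]\<close> with \<open>k \<in> K\<close> and \<open>a \<in> S\<close> would lie in \<open>S\<close>,
  orthogonal to \<open>1, e, z, a\<close>, contradicting \<open>dim S = 4\<close>. So \<open>K\<close> is central, whence commutators of
  symmetric elements are orthogonal to \<open>K\<close> and vanish, and \<open>R\<close> is again commutative.

  If \<open>dim K = 1\<close>, scale \<open>k \<in> K\<close> such that \<open>k\<^sup>3 = - k\<close>. Then \<open>p = - k\<^sup>2\<close> is a central idempotent. The
  symmetric elements of \<open>p R\<close> that anticommute with \<open>k\<close> form a plane spanned by \<open>a\<close> and \<open>a k\<close> with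
  \<open>a\<^sup>2 = p\<close>, so \<open>p R\<close> has basis \<open>p, k, a, a k\<close> and is \<open>M\<^sub>2(\<real>)\<close> with transposition. The complement is spanned
  by the orthogonal idempotents \<open>e\<close> and \<open>1 - p - e\<close>.
\<close>

section \<open>Algebras with a positive involution\<close>

text \<open>The type is the complex algebra \<open>A\<close> seen as a real algebra, and its real
  span is the set \<open>R\<close>. A conjugate-linear \<open>star\<close> is real-linear, and
  \<open>t\<close> will be the real part of the coefficient of \<open>1\<close>, so positivity can
  be required beyond \<open>R\<close>.\<close>

locale positive_involution_algebra = vector_space scl
  for scl :: "real \<Rightarrow> 'a::ring_1 \<Rightarrow> 'a"  (infixr \<open>\<cdot>\<close> 75) +
  fixes star :: "'a \<Rightarrow> 'a" and t :: "'a \<Rightarrow> real" and R :: "'a set" and e :: 'a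
  assumes scl_mult_left: "(r \<cdot> x) * y = r \<cdot> (x * y)"
    and scl_mult_right: "x * (r \<cdot> y) = r \<cdot> (x * y)"
    and star_add: "star (x + y) = star x + star y"
    and star_scl: "star (r \<cdot> x) = r \<cdot> star x"
    and star_mult: "star (x * y) = star y * star x"
    and star_star: "star (star x) = x"
    and t_add: "t (x + y) = t x + t y"
    and t_scl: "t (r \<cdot> x) = r * t x"
    and t_mult_commute: "t (x * y) = t (y * x)"
    and t_pos: "x \<noteq> 0 \<Longrightarrow> 0 < t (x * star x)"
    and subspace_R: "subspace R"
    and one_R: "1 \<in> R"
    and mult_R: "x \<in> R \<Longrightarrow> y \<in> R \<Longrightarrow> x * y \<in> R"
    and star_R: "x \<in> R \<Longrightarrow> star x \<in> R"
    and e_R: "e \<in> R"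
    and e_nonzero: "e \<noteq> 0"
    and e_idem: "e * e = e"
    and star_e: "star e = e"
    and e_central: "x \<in> R \<Longrightarrow> x * e = e * x"
    and e_minimal: "x \<in> R \<Longrightarrow> \<exists>r. x * e = r \<cdot> e"
begin

lemma star_minus: "star (- x) = - star x"
  using star_scl[of "-1" x] by simp

lemma star_diff: "star (x - y) = star x - star y"
  using star_add[of x "- y"] by (simp add: star_minus)

lemma star_0: "star 0 = 0"
  using star_scl[of 0 0] by simp

lemma star_1: "star 1 = 1"
  by (metis mult.left_neutral mult.right_neutral star_mult star_star)

lemma t_minus: "t (- x) = - t x"
  using t_scl[of "-1" x] by simp

lemma t_diff: "t (x - y) = t x - t y"
  using t_add[of x "- y"] by (simp add: t_minus)

lemma t_0: "t 0 = 0"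
  using t_scl[of 0 0] by simp

lemmas R_closed = mult_R star_R one_R e_R
  subspace_add[OF subspace_R] subspace_diff[OF subspace_R] subspace_neg[OF subspace_R]
  subspace_scale[OF subspace_R] subspace_0[OF subspace_R]

text \<open>In a bare \<open>ring_1\<close>, halving has to go through the scalars. Splittings into
  symmetric and skew parts are therefore used in doubled form,
  \<open>x + x = (x + star x) + (x - star x)\<close>.\<close>

lemma half_double: "x = (1/2) \<cdot> (x + x)"
  by (simp add: scale_right_distrib flip: scale_left_distrib)

lemma double_eq: "x + x = r \<cdot> y \<Longrightarrow> x = (r / 2) \<cdot> y"
  using half_double[of x] by simp

lemma double_cancel:
  fixes x y :: 'a
  shows "x + x = y + y \<Longrightarrow> x = y"
  using half_double[of x] half_double[of y] by simp

text \<open>\<open>k * e\<close> is a multiple of the symmetric \<open>e\<close>, but it is also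
  skew because \<open>k\<close> and \<open>e\<close> commute.\<close>

lemma e_mult_skew:
  assumes "k \<in> R" "star k = - k"
  shows "e * k = 0" "k * e = 0"
proof -
  obtain r where r: "k * e = r \<cdot> e" using e_minimal assms by blast
  have "star (k * e) = - (k * e)"
    using assms e_central by (simp add: star_mult star_e)
  then have "r \<cdot> e = - (r \<cdot> e)" using r by (simp add: star_scl star_e)
  then have "r \<cdot> e + r \<cdot> e = 0 + 0" by (metis add.right_inverse add_0)
  then have "r \<cdot> e = 0" using double_cancel by blast
  then show "k * e = 0" using r by simp
  then show "e * k = 0" using e_central assms by simp
qed

lemma symmetric_square_nonzero:
  assumes "a \<noteq> 0" "star a = a"
  shows "0 < t (a * a)"
  using t_pos assms by force

lemma skew_square_neg:
  assumes "k \<noteq> 0" "star k = - k"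
  shows "t (k * k) < 0"
  using t_pos[of k] assms by (simp add: t_minus)

lemma commutative_if:
  assumes SS: "\<And>a b. \<lbrakk>a \<in> R; star a = a; b \<in> R; star b = b\<rbrakk> \<Longrightarrow> a * b = b * a"
    and SK: "\<And>a k. \<lbrakk>a \<in> R; star a = a; k \<in> R; star k = - k\<rbrakk> \<Longrightarrow> a * k = k * a"
    and KK: "\<And>k l. \<lbrakk>k \<in> R; star k = - k; l \<in> R; star l = - l\<rbrakk> \<Longrightarrow> k * l = l * k"
    and x: "x \<in> R" and y: "y \<in> R"
  shows "x * y = y * x"
proof -
  define a k b l where abs: "a = x + star x" "k = x - star x" "b = y + star y" "l = y - star y"
  have mem: "a \<in> R" "k \<in> R" "b \<in> R" "l \<in> R" unfolding abs using x y by (auto intro: R_closed)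
  have st: "star a = a" "star k = - k" "star b = b" "star l = - l"
    unfolding abs by (simp_all add: star_add star_diff star_star add.commute)
  have xx: "x + x = a + k" and yy: "y + y = b + l" unfolding abs by simp_all
  have "(a + k) * (b + l) = (b + l) * (a + k)"
    using SS[of a b] SK[of a l] SK[of b k] KK[of k l] mem st by (simp add: algebra_simps)
  then have "(x + x) * (y + y) = (y + y) * (x + x)" using xx yy by simp
  then have "(x * y + x * y) + (x * y + x * y) = (y * x + y * x) + (y * x + y * x)"
    by (simp add: algebra_simps)
  then show ?thesis using double_cancel by blast
qed

lemma commute_all_if:
  assumes S: "\<And>a. \<lbrakk>a \<in> R; star a = a\<rbrakk> \<Longrightarrow> a * p = p * a"
    and K: "\<And>k. \<lbrakk>k \<in> R; star k = - k\<rbrakk> \<Longrightarrow> k * p = p * k"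
    and x: "x \<in> R"
  shows "x * p = p * x"
proof -
  have "(x + star x) * p = p * (x + star x)"
    using x by (intro S) (auto intro: R_closed simp: star_add star_star add.commute)
  moreover have "(x - star x) * p = p * (x - star x)"
    using x by (intro K) (auto intro: R_closed simp: star_diff star_star)
  ultimately have "((x + star x) + (x - star x)) * p = p * ((x + star x) + (x - star x))"
    by (simp only: distrib_left distrib_right)
  then have "x * p + x * p = p * x + p * x" by (simp add: algebra_simps)
  then show ?thesis by (rule double_cancel)
qed

section \<open>Trace orthogonality and the case of a skew plane\<close>

lemma orthogonal_span:
  assumes "\<And>u. u \<in> U \<Longrightarrow> t (w * u) = 0" "x \<in> span U"
  shows "t (w * x) = 0"
  using assms(2)
proof (induction rule: span_induct_alt)
  case base then show ?case by (simp add: t_0)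
next
  case (step c x y)
  then show ?case using assms(1) by (simp add: distrib_left t_add scl_mult_right t_scl)
qed

text \<open>By cyclicity of \<open>t\<close>,
  \<open>t (y * x * z) = t (y * z * x) = t (x * y * z)\<close>. This and the next lemma supply the
  orthogonality of commutators used below.\<close>

lemma t_commutator_commuting: "x * z = z * x \<Longrightarrow> t ((x * y - y * x) * z) = 0"
  by (simp add: left_diff_distrib t_diff) (metis mult.assoc t_mult_commute)

lemma t_commutator_self: "t ((x * y - y * x) * y) = 0"
  by (simp add: left_diff_distrib t_diff) (metis mult.assoc t_mult_commute)

text \<open>\<open>{k1, k2}\<close> is a basis of the skew elements; \<open>T\<close> encodes the
  bound 4 on the dimension of the symmetric ones.\<close>

lemma skew_plane_imp_commutative:
  assumes k1: "k1 \<in> R" "star k1 = - k1" "k1 \<noteq> 0"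
    and k2: "k2 \<in> R" "star k2 = - k2" and indep: "\<And>r. k2 \<noteq> r \<cdot> k1"
    and skew: "\<And>k. \<lbrakk>k \<in> R; star k = - k\<rbrakk> \<Longrightarrow> k \<in> span {k1, k2}"
    and sym: "\<And>a. \<lbrakk>a \<in> R; star a = a\<rbrakk> \<Longrightarrow> a \<in> span T"
    and T: "finite T" "card T \<le> 4"
    and x: "x \<in> R" and y: "y \<in> R"
  shows "x * y = y * x"
proof -
  have k12: "k1 * k2 = k2 * k1"
  proof -
    define w where "w = k1 * k2 - k2 * k1"
    have sw: "star w = - w" and wR: "w \<in> R"
      unfolding w_def using k1 k2 by (auto simp: star_diff star_mult intro: R_closed)
    have "t (w * u) = 0" if "u \<in> {k1, k2}" for u
      using that t_commutator_commuting[of k1 k1 k2] t_commutator_self[of k1 k2]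
      unfolding w_def by auto
    then have "t (w * w) = 0" using orthogonal_span skew[OF wR sw] by blast
    then have "w = 0" using skew_square_neg[OF _ sw] by fastforce
    then show ?thesis unfolding w_def by simp
  qed
  have in_span: "\<exists>r s. k = r \<cdot> k1 + s \<cdot> k2" if k: "k \<in> R" "star k = - k" for k
  proof -
    obtain r s where "k - r \<cdot> k1 = s \<cdot> k2"
      using skew[OF k] unfolding span_insert[of k1] span_insert[of k2] by auto
    then show ?thesis by (metis add.commute diff_add_cancel)
  qed
  have "\<exists>z \<in> {k1 * k1, k1 * k2}. z \<notin> span {1, e}"
  proof (rule ccontr)
    assume "\<not> ?thesis"
    then have zs: "z \<in> span {1, e}" if "z \<in> {k1 * k1, k1 * k2}" for z using that by blast
    \<comment> \<open>\<open>e\<close> kills products of skew elements, which leaves only the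
      multiples of \<open>1 - e\<close> in \<open>span {1, e}\<close>.\<close>
    have *: "\<exists>r. z = r \<cdot> (1 - e)" if z: "z \<in> {k1 * k1, k1 * k2}" for z
    proof -
      obtain r s where rs: "z - r \<cdot> 1 = s \<cdot> e"
        using zs[OF z] unfolding span_insert[of 1] span_insert[of e] by auto
      have "e * z = 0" using z e_mult_skew[OF k1(1,2)] by (auto simp flip: mult.assoc)
      moreover have "e * (z - r \<cdot> 1) = s \<cdot> e"
        using rs by (simp add: scl_mult_right e_idem)
      ultimately have "- (r \<cdot> e) = s \<cdot> e" by (simp add: right_diff_distrib scl_mult_right)
      then have "z - r \<cdot> 1 = - (r \<cdot> e)" using rs by simp
      then have "z = r \<cdot> (1 - e)" by (simp add: scale_right_diff_distrib algebra_simps)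
      then show ?thesis by blast
    qed
    obtain r s where r: "k1 * k1 = r \<cdot> (1 - e)" and s: "k1 * k2 = s \<cdot> (1 - e)"
      using * by blast
    have "k1 * k1 * k2 = r \<cdot> k2" unfolding r
      using e_mult_skew[OF k2] by (simp add: scl_mult_left left_diff_distrib)
    moreover have "k1 * (k1 * k2) = s \<cdot> k1" unfolding s
      using e_mult_skew[OF k1(1,2)] by (simp add: scl_mult_right right_diff_distrib)
    \<comment> \<open>Both computations evaluate \<open>k1 * k1 * k2\<close>, since
      \<open>1 - e\<close> acts as the identity on skew elements.\<close>
    ultimately have rs: "r \<cdot> k2 = s \<cdot> k1" by (simp add: mult.assoc)
    have "r \<noteq> 0" using r skew_square_neg[OF k1(3,2)] by (auto simp: t_0)
    then have "k2 = (s / r) \<cdot> k1" using rs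
      by (metis (no_types, opaque_lifting) divide_inverse_commute scale_left_imp_eq scale_scale
          mult.assoc mult.commute mult_1 right_inverse)
    then show False using indep by blast
  qed
  then obtain z where z: "z \<in> {k1 * k1, k1 * k2}" "z \<notin> span {1, e}" by blast
  have zR: "z \<in> R" and sz: "star z = z"
    using z k1 k2 k12 by (auto simp: star_mult intro: R_closed)
  have zk: "z * k1 = k1 * z" "z * k2 = k2 * z" using z k12 by (auto simp: mult.assoc) (metis mult.assoc)+
  have "1 \<notin> span {e}"
  proof
    assume "1 \<in> span {e}"
    then obtain r where "1 = r \<cdot> e" unfolding span_insert[of e] by auto
    then have "k1 * 1 = k1 * (r \<cdot> e)" by simp
    then show False using k1 e_mult_skew[OF k1(1,2)] by (simp add: scl_mult_right)
  qed
  moreover have "independent {e}" using e_nonzero by simp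
  ultimately have ind: "independent {z, 1, e}" using z by (simp add: independent_insert)
  have c3: "card {z, 1, e} = 3"
    using \<open>1 \<notin> span {e}\<close> z by (metis card_3_iff insert_commute span_base insertI1 insertI2)
  have ka: "k * a = a * k" if k: "k \<in> {k1, k2}" and a: "a \<in> R" "star a = a" for k a
  proof (rule ccontr)
    assume nc: "k * a \<noteq> a * k"
    have kk: "k \<in> R" "star k = - k" using k k1 k2 by auto
    define w where "w = k * a - a * k"
    have w0: "w \<noteq> 0" using nc w_def by simp
    have sw: "star w = w" and wR: "w \<in> R"
      unfolding w_def using a kk by (auto simp: star_diff star_mult intro: R_closed)
    have com: "k * u = u * k" if "u \<in> {z, 1, e}" for u
      using that zk k e_central[OF kk(1)] by auto
    have "k * u = u * k" if "u \<in> span {z, 1, e}" for u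
      using that
      by (induction rule: span_induct_alt)
        (simp_all add: com distrib_left distrib_right scl_mult_left scl_mult_right)
    \<comment> \<open>\<open>k\<close> commutes with all of \<open>span {z, 1, e}\<close> but not
      with \<open>a\<close>.\<close>
    then have an: "a \<notin> span {z, 1, e}" using nc by metis
    have "t (w * u) = 0" if "u \<in> {a, z, 1, e}" for u
      using that t_commutator_commuting[of k _ a] t_commutator_self[of k a] com
      unfolding w_def by auto
    then have "w \<notin> span {a, z, 1, e}"
      using orthogonal_span symmetric_square_nonzero[OF w0 sw] by (metis less_irrefl)
    then have indw: "independent {w, a, z, 1, e}"
      using an ind by (simp add: independent_insert)
    have "w \<notin> {a, z, 1, e}" using \<open>w \<notin> span {a, z, 1, e}\<close> by (metis span_base)
    moreover have "a \<notin> {z, 1, e}" using an by (metis span_base)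
    ultimately have "card {w, a, z, 1, e} = Suc (Suc (card {z, 1, e}))"
      by (metis card_insert_disjoint finite.emptyI finite.insertI)
    then have "card {w, a, z, 1, e} = 5" using c3 by simp
    moreover have "{w, a, z, 1, e} \<subseteq> span T"
      using sym a wR sw zR sz one_R star_1 e_R star_e by auto
    then have "card {w, a, z, 1, e} \<le> card T"
      using independent_span_bound[OF T(1) indw] by blast
    ultimately show False using T by simp
  qed
  have SK: "a * k = k * a" if "a \<in> R" "star a = a" "k \<in> R" "star k = - k" for a k
    using in_span[OF that(3,4)] ka[of k1 a] ka[of k2 a] that
    by (auto simp: distrib_left distrib_right scl_mult_left scl_mult_right)
  have KK: "k * l = l * k" if "k \<in> R" "star k = - k" "l \<in> R" "star l = - l" for k l
    using in_span[OF that(1,2)] in_span[OF that(3,4)] k12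
    by (auto simp: distrib_left distrib_right scl_mult_left scl_mult_right scale_right_distrib mult.commute add_ac)
  have SS: "a * b = b * a" if a: "a \<in> R" "star a = a" and b: "b \<in> R" "star b = b" for a b
  proof -
    define w where "w = a * b - b * a"
    have sw: "star w = - w" and wR: "w \<in> R"
      unfolding w_def using a b by (auto simp: star_diff star_mult intro: R_closed)
    \<comment> \<open>The skew \<open>w\<close> commutes with \<open>a\<close> by \<open>SK\<close>,
      so this commutator is orthogonal to itself.\<close>
    have "t (w * w) = 0"
      using t_commutator_commuting[of a w b] SK[OF a wR sw] unfolding w_def by simp
    then have "w = 0" using skew_square_neg[OF _ sw] by fastforce
    then show ?thesis unfolding w_def by simp
  qed
  show ?thesis using commutative_if[OF SS SK KK x y] by blast
qed

end

section \<open>A one-dimensional space of skew elements\<close>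

context positive_involution_algebra
begin

text \<open>The cube of \<open>k0\<close> is skew, hence \<open>c \<cdot> k0\<close>. The trace of
  the fourth power is positive and equals \<open>c * t (k0 * k0)\<close> with a negative second
  factor, so \<open>c < 0\<close>; scaling by \<open>1 / sqrt (- c)\<close> turns \<open>c\<close>
  into -1.\<close>

lemma normalize_skew_line:
  assumes k0: "k0 \<in> R" "star k0 = - k0" "k0 \<noteq> 0"
    and line: "\<And>l. \<lbrakk>l \<in> R; star l = - l\<rbrakk> \<Longrightarrow> \<exists>r. l = r \<cdot> k0"
  obtains k where "k \<in> R" "star k = - k" "k \<noteq> 0" "k * (k * k) = - k"
    "\<And>l. \<lbrakk>l \<in> R; star l = - l\<rbrakk> \<Longrightarrow> \<exists>r. l = r \<cdot> k"
proof -
  obtain c where c: "k0 * (k0 * k0) = c \<cdot> k0"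
    using line[of "k0 * (k0 * k0)"] k0 by (auto simp: star_mult mult.assoc intro: R_closed)
  have neg: "t (k0 * k0) < 0" using skew_square_neg k0 by blast
  have "0 < t ((k0 * k0) * (k0 * k0))"
    using neg k0 by (intro symmetric_square_nonzero) (auto simp: star_mult t_0)
  also have "(k0 * k0) * (k0 * k0) = c \<cdot> (k0 * k0)"
    using c by (simp add: mult.assoc scl_mult_right)
  finally have "c < 0" using neg by (simp add: t_scl zero_less_mult_iff)
  define s where "s = 1 / sqrt (- c)"
  have s: "s * s * c = -1" "s \<noteq> 0" using \<open>c < 0\<close> by (auto simp: s_def)
  show ?thesis
  proof (rule that[of "s \<cdot> k0"])
    show "s \<cdot> k0 \<in> R" "star (s \<cdot> k0) = - (s \<cdot> k0)" "s \<cdot> k0 \<noteq> 0"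
      using k0 s by (auto intro: R_closed simp: star_scl)
    have "(s \<cdot> k0) * ((s \<cdot> k0) * (s \<cdot> k0)) = (s * (s * s * c)) \<cdot> k0"
      using c by (simp add: scl_mult_left scl_mult_right mult.assoc)
    then show "(s \<cdot> k0) * ((s \<cdot> k0) * (s \<cdot> k0)) = - (s \<cdot> k0)" using s by simp
    fix l assume "l \<in> R" "star l = - l"
    then obtain r where "l = r \<cdot> k0" using line by blast
    then have "l = (r / s) \<cdot> (s \<cdot> k0)" using s by simp
    then show "\<exists>r. l = r \<cdot> (s \<cdot> k0)" by blast
  qed
qed

end

section \<open>The idempotent \<open>p\<close> and its corner \<open>p R\<close>\<close>

locale skew_line_algebra = positive_involution_algebra scl star t R e
  for scl :: "real \<Rightarrow> 'a::ring_1 \<Rightarrow> 'a"  (infixr \<open>\<cdot>\<close> 75)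
    and star t R e +
  fixes k p :: 'a
  assumes k_R: "k \<in> R" and star_k: "star k = - k" and k_nonzero: "k \<noteq> 0"
    and k_cube: "k * (k * k) = - k"
    and skew_line: "\<lbrakk>l \<in> R; star l = - l\<rbrakk> \<Longrightarrow> \<exists>r. l = r \<cdot> k"
    and p_def: "p = - (k * k)"
begin

lemma p_R: "p \<in> R"
  unfolding p_def using k_R by (auto intro: R_closed)

lemma star_p: "star p = p"
  unfolding p_def by (simp add: star_minus star_mult star_k)

lemma k_p: "k * p = k" and p_k: "p * k = k"
  unfolding p_def using k_cube by (simp_all add: mult.assoc)

lemma k_k: "k * k = - p"
  by (simp add: p_def)

lemma p_idem: "p * p = p"
  using k_k p_k by (metis minus_mult_commute mult.assoc mult_minus_left minus_equation_iff)

lemma p_nonzero: "p \<noteq> 0"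
  using k_p k_nonzero by force

lemma anticommutator_k:
  assumes "a \<in> R" "star a = a"
  obtains r where "a * k + k * a = r \<cdot> k"
proof -
  have "\<exists>r. a * k + k * a = r \<cdot> k"
    using assms k_R by (intro skew_line) (auto intro: R_closed simp: star_add star_mult star_k)
  then show ?thesis using that by blast
qed

text \<open>Moving a symmetric \<open>a\<close> past \<open>k\<close> costs a sign and a multiple of
  \<open>k\<close>; after moving it past \<open>k\<close> twice, the signs and the extra terms
  cancel.\<close>

lemma p_central:
  assumes "x \<in> R"
  shows "x * p = p * x"
proof (rule commute_all_if[OF _ _ assms])
  fix a assume "a \<in> R" "star a = a"
  then obtain r where r: "a * k + k * a = r \<cdot> k" by (rule anticommutator_k)
  then have ak: "a * k = r \<cdot> k - k * a" by (simp add: eq_diff_eq)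
  have "a * k * k = r \<cdot> (k * k) - k * (a * k)"
    unfolding ak by (simp add: left_diff_distrib scl_mult_left mult.assoc)
      (simp add: ak right_diff_distrib scl_mult_right)
  also have "\<dots> = k * k * a"
    unfolding ak by (simp add: right_diff_distrib scl_mult_right mult.assoc)
  finally show "a * p = p * a" unfolding p_def by (simp add: mult.assoc)
next
  fix l assume "l \<in> R" "star l = - l"
  then obtain r where "l = r \<cdot> k" using skew_line by blast
  then show "l * p = p * l" by (simp add: k_p p_k scl_mult_left scl_mult_right)
qed

text \<open>The anticommutator of \<open>u\<close> and \<open>k\<close> is twice
  \<open>u * k\<close> and a multiple of \<open>k\<close>. Multiplying by \<open>k\<close> replaces
  \<open>k * k\<close> by \<open>- p\<close>, and \<open>p\<close> fixes \<open>u\<close>.\<close>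

lemma symmetric_commuting_k:
  assumes u: "u \<in> R" "star u = u" "p * u = u" and comm: "u * k = k * u"
  obtains r where "u = r \<cdot> p"
proof -
  obtain r where "u * k + k * u = r \<cdot> k" using anticommutator_k u by blast
  then have "u * k = (r / 2) \<cdot> k" using double_eq comm by simp
  then have "u * k * k = (r / 2) \<cdot> (k * k)" by (simp add: scl_mult_left)
  moreover have "u * p = u" using p_central u by simp
  ultimately have "u = (r / 2) \<cdot> p" by (simp add: mult.assoc k_k)
  then show ?thesis using that by blast
qed

text \<open>In the matrix picture reached later, with \<open>k\<close> a rotation by a right angle,
  these are the symmetric matrices of trace zero.\<close>

definition V :: "'a set"
  where "V = {v \<in> R. star v = v \<and> p * v = v \<and> v * k = - (k * v)}"

text \<open>Half the anticommutator coefficient measures the part of \<open>p * a\<close> that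
  commutes with \<open>k\<close>; subtracting it is the analogue of making a symmetric matrix
  traceless.\<close>

lemma symmetric_corner:
  assumes a: "a \<in> R" "star a = a"
  obtains r where "p * a - r \<cdot> p \<in> V"
proof -
  obtain s where s: "a * k + k * a = s \<cdot> k" using anticommutator_k a by blast
  define r where "r = s / 2"
  have r: "a * k = r \<cdot> k + r \<cdot> k - k * a"
    using s by (simp add: r_def eq_diff_eq flip: scale_left_distrib)
  have "(p * a - r \<cdot> p) * k = a * k - r \<cdot> k"
    using p_central[OF a(1)]
    by (simp add: left_diff_distrib scl_mult_left p_k)
      (metis mult.assoc p_k)
  moreover have "k * (p * a - r \<cdot> p) = k * a - r \<cdot> k"
    by (simp add: right_diff_distrib scl_mult_right k_p flip: mult.assoc)
  ultimately have "(p * a - r \<cdot> p) * k = - (k * (p * a - r \<cdot> p))"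
    by (simp add: r)
  moreover have "p * (p * a - r \<cdot> p) = p * a - r \<cdot> p"
    by (simp add: right_diff_distrib scl_mult_right p_idem flip: mult.assoc)
  moreover have "star (p * a - r \<cdot> p) = p * a - r \<cdot> p"
    using p_central a by (simp add: star_diff star_mult star_scl star_p)
  ultimately have "p * a - r \<cdot> p \<in> V"
    using a p_R by (auto simp: V_def intro: R_closed)
  then show ?thesis using that by blast
qed

text \<open>Without \<open>V\<close>, every symmetric \<open>a\<close> has
  \<open>p * a = r \<cdot> p\<close>. A commutator of symmetric elements is a multiple of
  \<open>k\<close>, so \<open>p\<close> fixes it; but multiplication by \<open>p\<close> turns it
  into a commutator of multiples of \<open>p\<close>, which is 0.\<close>

lemma V_trivial_imp_commutative:
  assumes V: "V \<subseteq> {0}" and x: "x \<in> R" and y: "y \<in> R"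
  shows "x * y = y * x"
proof (rule commutative_if[OF _ _ _ x y])
  have corner: "\<exists>r. p * a = r \<cdot> p" if a: "a \<in> R" "star a = a" for a
  proof -
    obtain r where "p * a - r \<cdot> p \<in> V" by (rule symmetric_corner[OF a])
    then have "p * a = r \<cdot> p" using V by auto
    then show ?thesis by blast
  qed
  have pp: "p * (x * y) = (p * x) * (p * y)" if x: "x \<in> R" for x y
  proof -
    have "(p * x) * (p * y) = p * (x * p) * y" by (simp add: mult.assoc)
    also have "\<dots> = (p * p) * x * y" unfolding p_central[OF x] by (simp add: mult.assoc)
    finally show ?thesis by (simp add: p_idem mult.assoc)
  qed
  fix a assume a: "a \<in> R" "star a = a"
  then obtain r where r: "p * a = r \<cdot> p" using corner by blast
  {
    fix b assume b: "b \<in> R" "star b = b"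
    then obtain s where s: "p * b = s \<cdot> p" using corner by blast
    have "\<exists>q. a * b - b * a = q \<cdot> k"
      using a b by (intro skew_line) (auto intro: R_closed simp: star_diff star_mult)
    then obtain q where q: "a * b - b * a = q \<cdot> k" by blast
    have "p * (a * b - b * a) = (p * a) * (p * b) - (p * b) * (p * a)"
      using pp a b by (simp add: right_diff_distrib)
    also have "\<dots> = 0"
      unfolding r s by (simp add: scl_mult_left scl_mult_right scale_left_commute mult.commute)
    finally have "q \<cdot> k = 0" unfolding q by (simp add: scl_mult_right p_k)
    then show "a * b = b * a" using q by (metis eq_iff_diff_eq_0)
  next
    fix l assume "l \<in> R" "star l = - l"
    then obtain q where l: "l = q \<cdot> k" using skew_line by blast
    have "a * k = (p * a) * k" using p_central[OF a(1)] p_k by (metis mult.assoc)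
    moreover have "k * a = k * (p * a)" using k_p by (metis mult.assoc)
    ultimately have "a * k = k * a"
      unfolding r by (simp add: scl_mult_left scl_mult_right p_k k_p)
    then show "a * l = l * a" unfolding l by (simp add: scl_mult_left scl_mult_right)
  }
next
  fix l m assume "l \<in> R" "star l = - l" "m \<in> R" "star m = - m"
  then obtain q s where "l = q \<cdot> k" "m = s \<cdot> k" using skew_line by meson
  then show "l * m = m * l"
    by (simp add: scl_mult_left scl_mult_right mult.commute)
qed

text \<open>Since \<open>v\<close> anticommutes with \<open>k\<close>, its square commutes with
  \<open>k\<close> and is \<open>q \<cdot> p\<close>. Comparing the traces of \<open>v * v\<close>
  and \<open>p\<close> gives \<open>q > 0\<close>, so \<open>v\<close> can be normalized.\<close>

lemma V_unit_exists:
  assumes "\<not> V \<subseteq> {0}"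
  obtains a where "a \<in> V" "a * a = p"
proof -
  obtain v where v: "v \<in> V" "v \<noteq> 0" using assms by blast
  then have vR: "v \<in> R" and sv: "star v = v" and pv: "p * v = v" and vk: "v * k = - (k * v)"
    by (auto simp: V_def)
  have "v * v * k = k * (v * v)"
    by (simp add: mult.assoc vk) (simp add: vk flip: mult.assoc)
  then obtain q where q: "v * v = q \<cdot> p"
    using symmetric_commuting_k[of "v * v"] vR sv pv
    by (metis mult_R star_mult mult.assoc)
  have "0 < t (v * v)" "0 < t (p * p)"
    using symmetric_square_nonzero v(2) sv p_nonzero star_p by blast+
  then have "0 < q" unfolding q p_idem t_scl by (simp add: zero_less_mult_iff)
  define s where "s = 1 / sqrt q"
  have s: "s * s * q = 1" using \<open>0 < q\<close> by (simp add: s_def)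
  show ?thesis
  proof (rule that[of "s \<cdot> v"])
    show "s \<cdot> v \<in> V"
      using vR sv pv vk by (auto simp: V_def star_scl scl_mult_left scl_mult_right intro: R_closed)
    have "(s \<cdot> v) * (s \<cdot> v) = (s * s * q) \<cdot> p"
      by (simp add: scl_mult_left scl_mult_right q mult.assoc)
    then show "(s \<cdot> v) * (s \<cdot> v) = p" using s by simp
  qed
qed

end

section \<open>The corner as an algebra of 2 by 2 matrices\<close>

locale matrix_component = skew_line_algebra scl star t R e k p
  for scl :: "real \<Rightarrow> 'a::ring_1 \<Rightarrow> 'a"  (infixr \<open>\<cdot>\<close> 75)
    and star t R e k p +
  fixes a :: 'a
  assumes a_V: "a \<in> V" and a_a: "a * a = p"
begin

lemma a_R: "a \<in> R" and star_a: "star a = a" and p_a: "p * a = a" and a_k: "a * k = - (k * a)"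
  using a_V by (auto simp: V_def)

lemma a_p: "a * p = a"
  using p_central[OF a_R] p_a by simp

text \<open>\<open>a * w + w * a\<close> commutes with \<open>k\<close>, hence is a multiple of
  \<open>p\<close>; \<open>a * w - w * a\<close> is skew, hence a multiple of \<open>k\<close>.
  Multiplying their sum by \<open>a\<close> on the left recovers twice \<open>w\<close>.\<close>

lemma V_span:
  assumes w: "w \<in> V"
  obtains r s where "w = r \<cdot> a + s \<cdot> (a * k)"
proof -
  have wR: "w \<in> R" and sw: "star w = w" and pw: "p * w = w" and wk: "w * k = - (k * w)"
    using w by (auto simp: V_def)
  have 1: "a * w * k = k * (a * w)"
    by (simp add: mult.assoc wk) (simp add: a_k flip: mult.assoc)
  have 2: "w * a * k = k * (w * a)"
    by (simp add: mult.assoc a_k) (simp add: wk flip: mult.assoc)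
  have "star (a * w + w * a) = a * w + w * a"
    by (simp add: star_add star_mult sw star_a add.commute)
  moreover have "p * (a * w + w * a) = a * w + w * a"
    by (simp add: distrib_left p_a pw flip: mult.assoc)
  moreover have "(a * w + w * a) * k = k * (a * w + w * a)"
    using 1 2 by (simp add: distrib_left distrib_right)
  ultimately obtain r where r: "a * w + w * a = r \<cdot> p"
    using symmetric_commuting_k[of "a * w + w * a"] wR a_R by (metis mult_R subspace_R subspace_add)
  have "\<exists>s. a * w - w * a = s \<cdot> k"
    using wR a_R by (intro skew_line) (auto intro: R_closed simp: star_diff star_mult sw star_a)
  then obtain s where s: "a * w - w * a = s \<cdot> k" by blast
  have "a * w + a * w = r \<cdot> p + s \<cdot> k" unfolding r[symmetric] s[symmetric] by simp
  then have "a * (a * w + a * w) = a * (r \<cdot> p + s \<cdot> k)" by simp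
  then have "w + w = r \<cdot> a + s \<cdot> (a * k)"
    by (simp add: distrib_left scl_mult_right a_a pw a_p flip: mult.assoc)
  then have "w = (1/2) \<cdot> (r \<cdot> a + s \<cdot> (a * k))" by (subst half_double) simp
  then have "w = (r/2) \<cdot> a + (s/2) \<cdot> (a * k)" by (simp add: scale_right_distrib)
  then show ?thesis using that by blast
qed

lemma corner_span:
  assumes x: "x \<in> R"
  shows "p * x \<in> span {p, k, a, a * k}"
proof -
  have U: "p \<in> span {p, k, a, a * k}" "k \<in> span {p, k, a, a * k}"
    "a \<in> span {p, k, a, a * k}" "a * k \<in> span {p, k, a, a * k}"
    by (auto intro: span_base)
  have "x + star x \<in> R" "star (x + star x) = x + star x"
    using x by (auto intro: R_closed simp: star_add star_star add.commute)
  then obtain r where "p * (x + star x) - r \<cdot> p \<in> V" by (rule symmetric_corner)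
  then obtain q s where "p * (x + star x) - r \<cdot> p = q \<cdot> a + s \<cdot> (a * k)" by (rule V_span)
  then have "p * (x + star x) = r \<cdot> p + (q \<cdot> a + s \<cdot> (a * k))" by (simp add: diff_eq_eq add.commute)
  then have sym: "p * (x + star x) \<in> span {p, k, a, a * k}"
    using U by (auto intro!: span_add span_scale)
  have "x - star x \<in> R" "star (x - star x) = - (x - star x)"
    using x by (auto intro: R_closed simp: star_diff star_star)
  then obtain m where "x - star x = m \<cdot> k" using skew_line by blast
  then have "p * (x - star x) = m \<cdot> k" by (simp add: scl_mult_right p_k)
  then have "p * (x - star x) \<in> span {p, k, a, a * k}" using U by (auto intro!: span_scale)
  with sym have "p * (x + star x) + p * (x - star x) \<in> span {p, k, a, a * k}" by (rule span_add)
  moreover have "p * (x + star x) + p * (x - star x) = p * x + p * x" by (simp add: algebra_simps)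
  ultimately have "(1/2) \<cdot> (p * x + p * x) \<in> span {p, k, a, a * k}" by (metis span_scale)
  then show ?thesis using half_double[of "p * x"] by simp
qed

section \<open>The remaining idempotent, the matrix units and the isomorphism\<close>

definition f :: 'a
  where "f = 1 - p - e"

lemma e_k: "e * k = 0" and k_e: "k * e = 0"
  using e_mult_skew[OF k_R star_k] by auto

lemma p_e: "p * e = 0" and e_p: "e * p = 0"
  by (simp_all add: p_def e_k k_e mult.assoc) (simp add: e_k flip: mult.assoc)

lemma a_e: "a * e = 0" and e_a: "e * a = 0"
  using a_p p_a p_e e_p by (metis mult.assoc mult_zero_right, metis mult.assoc mult_zero_left)

lemma f_R: "f \<in> R"
  unfolding f_def using p_R by (auto intro: R_closed)

lemma f_mult: "f * f = f" "f * e = 0" "e * f = 0" "f * a = 0" "a * f = 0" "f * k = 0" "k * f = 0"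
  unfolding f_def
  by (simp_all add: algebra_simps p_idem e_idem p_e e_p e_a a_e p_a a_p k_p p_k e_k k_e)

text \<open>If \<open>1 = p + e\<close>, then \<open>R = p R + e R\<close> is spanned by five
  elements, too few for dimension 6.\<close>

lemma f_nonzero:
  assumes B: "finite B" "independent B" "R = span B" "card B = 6"
  shows "f \<noteq> 0"
proof
  assume "f = 0"
  then have 1: "1 = p + e" by (simp add: f_def diff_eq_eq add.commute)
  have "R \<subseteq> span {e, p, k, a, a * k}"
  proof
    fix x assume x: "x \<in> R"
    have "x = p * x + e * x" using 1 by (metis distrib_right mult_1)
    moreover obtain r where "e * x = r \<cdot> e" using e_minimal e_central x by metis
    moreover have "p * x \<in> span {e, p, k, a, a * k}"
      using corner_span[OF x] span_mono[of "{p, k, a, a * k}"] by blast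
    ultimately show "x \<in> span {e, p, k, a, a * k}"
      by (metis span_add span_base span_scale insertI1)
  qed
  then have "B \<subseteq> span {e, p, k, a, a * k}" using B span_superset by fast
  then have "card B \<le> card {e, p, k, a, a * k}"
    by (rule conjunct2[OF independent_span_bound[OF _ B(2)], rotated]) simp
  also have "\<dots> \<le> 5" by (simp add: card_insert_le_m1)
  finally show False using B by simp
qed

text \<open>With \<open>p\<close> as the identity, \<open>a\<close> as diag(1, -1) and
  \<open>k\<close> as E12 - E21, these are twice the matrix units. The factor 1/2 is split off so
  that products can be checked without scalars.\<close>

definition double_unit :: "2 \<Rightarrow> 2 \<Rightarrow> 'a"
  where "double_unit i j =
    (if i = j then (if i = 1 then p + a else p - a) else (if i = 1 then a * k + k else a * k - k))"

definition unit :: "2 \<Rightarrow> 2 \<Rightarrow> 'a"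
  where "unit i j = (1/2) \<cdot> double_unit i j"

definition \<psi> :: "RRM2 \<Rightarrow> 'a"
  where "\<psi> = (\<lambda>(x, y, M). x \<cdot> e + y \<cdot> f + (\<Sum>i\<in>UNIV. \<Sum>j\<in>UNIV. M $ i $ j \<cdot> unit i j))"

lemma unit_mult: "unit i j * unit l m = (if j = l then unit i m else 0)"
proof -
  have aak: "a * (a * k) = k" by (simp add: a_a p_k flip: mult.assoc)
  have aka: "a * k * a = - k" by (simp add: a_k mult.assoc a_a k_p)
  have akk: "a * k * k = - a" by (simp add: mult.assoc k_k a_p)
  have kak: "k * (a * k) = a" by (simp add: a_k mult.assoc) (simp add: k_k p_a flip: mult.assoc)
  have akak: "a * k * (a * k) = p" by (simp add: mult.assoc kak a_a)
  have ka: "k * a = - (a * k)" by (simp add: a_k)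
  have pak: "p * (a * k) = a * k" by (simp add: p_a flip: mult.assoc)
  have akp: "a * k * p = a * k" by (simp add: k_p mult.assoc)
  have two: "(1::2) \<noteq> 2" "(2::2) \<noteq> 1" by simp_all
  \<comment> \<open>The index quantifiers expand into sixteen products, each settled by the
    multiplication table of \<open>p\<close>, \<open>k\<close>, \<open>a\<close>,
    \<open>a * k\<close>.\<close>
  have "\<forall>i j l m. double_unit i j * double_unit l m
      = (if j = l then double_unit i m + double_unit i m else 0)"
    unfolding forall_2 double_unit_def
    by (simp add: two distrib_left distrib_right left_diff_distrib right_diff_distrib
       p_idem p_a a_p k_p p_k a_a k_k aak aka akk kak akak ka pak akp add_ac)
  then have D: "double_unit i j * double_unit l m
      = (if j = l then double_unit i m + double_unit i m else 0)" by blast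
  have "unit i j * unit l m = (1/2) \<cdot> (1/2) \<cdot> (double_unit i j * double_unit l m)"
    unfolding unit_def scl_mult_left scl_mult_right ..
  also have "\<dots> = (if j = l then unit i m else 0)"
  proof (cases "j = l")
    case True
    then show ?thesis unfolding D unit_def by (simp only: simp_thms if_True half_double[symmetric])
  next
    case False
    then show ?thesis unfolding D by simp
  qed
  finally show ?thesis .
qed

lemma unit_R: "unit i j \<in> R"
  unfolding unit_def double_unit_def using p_R a_R k_R by (auto intro!: R_closed)

text \<open>\<open>p\<close>, \<open>a\<close> and \<open>a * k\<close> are symmetric, the last
  because \<open>a\<close> and \<open>k\<close> anticommute, while \<open>k\<close> is skew; so only
  the off-diagonal units are exchanged.\<close>

lemma star_unit: "star (unit i j) = unit j i"
proof -
  have "star (a * k) = a * k" by (simp add: star_mult star_a star_k) (simp add: a_k)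
  moreover have "i = 1 \<or> i = 2" "j = 1 \<or> j = 2" by (simp_all add: exhaust_2)
  ultimately show ?thesis
    by (auto simp: unit_def double_unit_def star_scl star_add star_diff star_p star_a star_k)
qed

lemma unit_ef: "e * unit i j = 0" "unit i j * e = 0" "f * unit i j = 0" "unit i j * f = 0"
proof -
  have "f * p = 0" "p * f = 0"
    by (simp_all add: f_def left_diff_distrib right_diff_distrib p_idem p_e e_p)
  moreover have "e * (a * k) = 0" "f * (a * k) = 0" "a * k * e = 0" "a * k * f = 0"
    by (simp_all add: e_a f_mult flip: mult.assoc) (simp_all add: k_e f_mult mult.assoc)
  ultimately show "e * unit i j = 0" "unit i j * e = 0" "f * unit i j = 0" "unit i j * f = 0"
    by (auto simp: unit_def double_unit_def scl_mult_left scl_mult_right distrib_left distrib_right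
       left_diff_distrib right_diff_distrib e_p p_e e_a a_e e_k k_e f_mult)
qed

lemma unit_diagonal: "unit 1 1 + unit 2 2 = p"
proof -
  have "(2::2) \<noteq> 1" by simp
  then show ?thesis by (simp add: unit_def double_unit_def half_double[symmetric] flip: scale_right_distrib)
qed

text \<open>Every unit factors through any given one, so if one vanished, the diagonal sum
  \<open>p\<close> would vanish too.\<close>

lemma unit_nonzero: "unit i j \<noteq> 0"
proof
  assume 0: "unit i j = 0"
  have "unit l m = 0" for l m
    using unit_mult[of l i i m] unit_mult[of i j j m] 0 by simp
  then show False using unit_diagonal p_nonzero by simp
qed

lemma \<psi>_eq:
  "\<psi> (x, y, M) = x \<cdot> e + y \<cdot> f + (M $ 1 $ 1 \<cdot> unit 1 1 + M $ 1 $ 2 \<cdot> unit 1 2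
    + (M $ 2 $ 1 \<cdot> unit 2 1 + M $ 2 $ 2 \<cdot> unit 2 2))"
  by (simp add: \<psi>_def sum_2)

lemma \<psi>_linear: "Vector_Spaces.linear scaleR scl \<psi>"
proof -
  have "\<psi> (u + v) = \<psi> u + \<psi> v" for u v
    by (cases u; cases v) (simp add: \<psi>_eq scale_left_distrib add_ac)
  moreover have "\<psi> (r *\<^sub>R u) = r \<cdot> \<psi> u" for r u
    by (cases u) (simp add: \<psi>_eq scale_right_distrib)
  ultimately show ?thesis
    unfolding Vector_Spaces.linear_iff using vector_space_axioms real_vector.vector_space_axioms by blast
qed

lemma \<psi>_one: "\<psi> RRM2_one = 1"
  by (simp add: RRM2_one_def \<psi>_eq mat_def unit_diagonal f_def)

lemma \<psi>_mult: "\<psi> (RRM2_mult u v) = \<psi> u * \<psi> v"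
proof -
  have two: "(1::2) \<noteq> 2" "(2::2) \<noteq> 1" by simp_all
  obtain x y M where u: "u = (x, y, M)" by (cases u)
  obtain x' y' N where v: "v = (x', y', N)" by (cases v)
  show ?thesis unfolding u v
    by (simp add: \<psi>_eq RRM2_mult_def distrib_left distrib_right scl_mult_left scl_mult_right
       e_idem f_mult unit_ef unit_mult two matrix_matrix_mult_def sum_2 scale_left_distrib scale_right_distrib mult.commute add_ac)
qed

lemma \<psi>_star: "star (\<psi> (0, 0, M)) = \<psi> (0, 0, transpose M)"
  by (simp add: \<psi>_eq star_add star_scl star_unit transpose_def add_ac)

lemma \<psi>_R: "\<psi> u \<in> R"
  by (cases u) (auto simp: \<psi>_eq intro!: R_closed unit_R f_R)

text \<open>Multiplication isolates each coordinate: by \<open>e\<close> and \<open>f\<close> for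
  the first two, by \<open>unit i i\<close> on the left and \<open>unit j j\<close> on the right for
  \<open>M $ i $ j\<close>.\<close>

lemma \<psi>_inj:
  assumes "f \<noteq> 0"
  shows "inj \<psi>"
proof -
  have "u = 0" if "\<psi> u = 0" for u
  proof -
    have two: "(1::2) \<noteq> 2" "(2::2) \<noteq> 1" by simp_all
    obtain x y M where u: "u = (x, y, M)" by (cases u)
    have "e * \<psi> u = x \<cdot> e" "f * \<psi> u = y \<cdot> f"
      unfolding u by (simp_all add: \<psi>_eq distrib_left scl_mult_right e_idem f_mult unit_ef)
    then have "x = 0" "y = 0" using that e_nonzero assms by auto
    moreover have "unit i i * \<psi> u * unit j j = M $ i $ j \<cdot> unit i j" for i j
      unfolding u using exhaust_2[of i] exhaust_2[of j]
      by (auto simp: \<psi>_eq distrib_left distrib_right scl_mult_left scl_mult_right unit_ef unit_mult two)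
    then have "M $ i $ j = 0" for i j using that unit_nonzero by auto
    then have "M = 0" by (simp add: vec_eq_iff)
    ultimately show ?thesis by (simp add: u zero_prod_def)
  qed
  moreover have "\<psi> (u - v) + \<psi> v = \<psi> u" for u v
    using \<psi>_linear unfolding Vector_Spaces.linear_iff by (metis diff_add_cancel)
  ultimately show ?thesis by (metis add_0 add_right_imp_eq eq_iff_diff_eq_0 injI)
qed

text \<open>Surjectivity is a dimension count: the six images of the standard basis are independent,
  and an element outside their span would give seven independent elements in
  \<open>span B\<close>.\<close>

lemma \<psi>_bij:
  assumes B: "finite B" "independent B" "R = span B" "card B = 6"
  shows "bij_betw \<psi> UNIV R"
proof -
  interpret pair: vector_space_pair "scaleR :: real \<Rightarrow> RRM2 \<Rightarrow> RRM2" scl by unfold_locales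
  have inj: "inj \<psi>" using \<psi>_inj f_nonzero[OF B] by blast
  define C where "C = \<psi> ` Basis"
  have indC: "independent C"
    using pair.linear_independent_injective_image[OF \<psi>_linear, of Basis] inj independent_Basis
    unfolding C_def dependent_raw_def by (metis inj_on_subset subset_UNIV)
  have "card (Basis :: RRM2 set) = 6" by simp
  then have cardC: "card C = 6" unfolding C_def using inj by (simp add: card_image inj_on_subset)
  have CR: "C \<subseteq> span B" unfolding C_def using \<psi>_R B by auto
  have spanC: "span C \<subseteq> range \<psi>"
    unfolding C_def pair.linear_span_image[OF \<psi>_linear] by blast
  have "R \<subseteq> span C"
  proof
    fix x assume x: "x \<in> R"
    show "x \<in> span C"
    proof (rule ccontr)
      assume "x \<notin> span C"
      then have "independent (insert x C)" "x \<notin> C"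
        using indC span_base by (auto simp: independent_insert)
      moreover have "insert x C \<subseteq> span B" using x CR B by auto
      ultimately have "card (insert x C) \<le> card B" using independent_span_bound B(1) by blast
      then show False using \<open>x \<notin> C\<close> cardC B
        by (metis C_def card_insert_disjoint finite_Basis finite_imageI Suc_n_not_le_n)
    qed
  qed
  then have "range \<psi> = R" using spanC \<psi>_R by blast
  then show ?thesis using inj by (simp add: bij_betw_def)
qed

end

context positive_involution_algebra
begin

text \<open>Noncommutativity makes \<open>V\<close> nontrivial and so provides \<open>a\<close>;
  dimension 6 makes \<open>\<psi>\<close> bijective.\<close>

theorem skew_line_imp_matrix_component:
  assumes k0: "k0 \<in> R" "star k0 = - k0" "k0 \<noteq> 0"
    and line: "\<And>l. \<lbrakk>l \<in> R; star l = - l\<rbrakk> \<Longrightarrow> l \<in> span {k0}"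
    and B: "finite B" "independent B" "R = span B" "card B = 6"
    and nc: "x \<in> R" "y \<in> R" "x * y \<noteq> y * x"
  obtains \<psi> where "bij_betw \<psi> UNIV R" "Vector_Spaces.linear scaleR scl \<psi>"
    "\<psi> RRM2_one = 1" "\<And>u v. \<psi> (RRM2_mult u v) = \<psi> u * \<psi> v"
    "\<And>M. star (\<psi> (0, 0, M)) = \<psi> (0, 0, transpose M)"
proof -
  have "\<exists>r. l = r \<cdot> k0" if "l \<in> R" "star l = - l" for l
    using line[OF that] unfolding span_insert[of k0] by auto
  from normalize_skew_line[OF k0 this]
  obtain k where k: "k \<in> R" "star k = - k" "k \<noteq> 0" "k * (k * k) = - k"
    "\<And>l. \<lbrakk>l \<in> R; star l = - l\<rbrakk> \<Longrightarrow> \<exists>r. l = r \<cdot> k" by blast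
  interpret skew_line_algebra scl star t R e k "- (k * k)"
    using k by unfold_locales auto
  obtain a where "a \<in> V" "a * a = - (k * k)"
    using V_unit_exists V_trivial_imp_commutative nc by metis
  then interpret matrix_component scl star t R e k "- (k * k)" a
    by unfold_locales
  show ?thesis
    using that[OF \<psi>_bij[OF B] \<psi>_linear \<psi>_one \<psi>_mult \<psi>_star] .
qed

end

section \<open>Counting fixed points of the involution\<close>

context positive_involution_algebra
begin

text \<open>These spanning sets turn the dimensions of the skew and symmetric parts of
  \<open>R\<close> into counts of \<open>star\<close>-orbits on \<open>B\<close>.\<close>

lemma
  assumes B: "R = span B" and x: "x \<in> R"
  shows diff_star_span: "x - star x \<in> span ((\<lambda>b. b - star b) ` B)"
    and add_star_span: "x + star x \<in> span ((\<lambda>b. b + star b) ` B)"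
proof -
  have "x \<in> span B" using assms by simp
  then have "x - star x \<in> span ((\<lambda>b. b - star b) ` B) \<and> x + star x \<in> span ((\<lambda>b. b + star b) ` B)"
  proof (induction rule: span_induct_alt)
    case base show ?case by (simp add: star_0 span_zero)
  next
    case (step c b y)
    have "c \<cdot> b + y - star (c \<cdot> b + y) = c \<cdot> (b - star b) + (y - star y)"
      "c \<cdot> b + y + star (c \<cdot> b + y) = c \<cdot> (b + star b) + (y + star y)"
      by (simp_all add: star_add star_scl scale_right_distrib scale_right_diff_distrib)
    moreover have "b - star b \<in> span ((\<lambda>b. b - star b) ` B)"
      "b + star b \<in> span ((\<lambda>b. b + star b) ` B)"
      using step(1) by (auto intro: span_base)
    ultimately show ?case using step(2) by (metis span_add span_scale)
  qed
  then show "x - star x \<in> span ((\<lambda>b. b - star b) ` B)"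
    "x + star x \<in> span ((\<lambda>b. b + star b) ` B)" by auto
qed

lemma skew_in_span:
  assumes "R = span B" "x \<in> R" "star x = - x"
  shows "x \<in> span ((\<lambda>b. b - star b) ` B)"
proof -
  have "(1/2) \<cdot> (x - star x) \<in> span ((\<lambda>b. b - star b) ` B)"
    using diff_star_span[OF assms(1,2)] by (rule span_scale)
  then show ?thesis using assms(3) half_double[of x] by simp
qed

lemma symmetric_in_span:
  assumes "R = span B" "x \<in> R" "star x = x"
  shows "x \<in> span ((\<lambda>b. b + star b) ` B)"
proof -
  have "(1/2) \<cdot> (x + star x) \<in> span ((\<lambda>b. b + star b) ` B)"
    using add_star_span[OF assms(1,2)] by (rule span_scale)
  then show ?thesis using assms(3) half_double[of x] by simp
qed

text \<open>As \<open>star\<close> permutes \<open>B\<close> and fixes \<open>1\<close>, it has 6, 4 or 2 fixed points on \<open>B\<close>.\<close>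

theorem rank_6_noncommutative:
  assumes B: "finite B" "independent B" "R = span B" "card B = 6"
    and star_B: "star ` B = B" and one_B: "1 \<in> B"
    and nc: "x \<in> R" "y \<in> R" "x * y \<noteq> y * x"
  shows "card {b \<in> B. star b = b} = 4"
    and "\<exists>\<psi>. bij_betw \<psi> UNIV R \<and> Vector_Spaces.linear scaleR scl \<psi> \<and> \<psi> RRM2_one = 1
      \<and> (\<forall>u v. \<psi> (RRM2_mult u v) = \<psi> u * \<psi> v)
      \<and> (\<forall>M. star (\<psi> (0, 0, M)) = \<psi> (0, 0, transpose M))"
proof -
  define F where "F = {b \<in> B. star b = b}"
  have sB: "star b \<in> B" if "b \<in> B" for b using that star_B by blast
  have F1: "1 \<in> F" by (simp add: F_def one_B star_1)
  have FB: "F \<subseteq> B" by (auto simp: F_def)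
  have BR: "B \<subseteq> R" using B span_superset by simp
  have fin: "finite F" using FB B finite_subset by blast
  \<comment> \<open>If \<open>star\<close> fixed all of \<open>B\<close>, it would be the identity
    on \<open>R\<close>, and \<open>x * y = star (x * y) = y * x\<close>.\<close>
  have "\<not> B \<subseteq> F"
  proof
    assume "B \<subseteq> F"
    then have "(\<lambda>b. b - star b) ` B \<subseteq> {0}" by (auto simp: F_def)
    then have "span ((\<lambda>b. b - star b) ` B) \<subseteq> {0}"
      by (intro span_minimal) auto
    then have "star z = z" if "z \<in> R" for z using diff_star_span[OF B(3) that] by auto
    then show False using nc by (metis mult_R star_mult)
  qed
  then obtain b where b: "b \<in> B" "star b \<noteq> b" by (auto simp: F_def)
  have sk: "z - star z \<in> R" "star (z - star z) = - (z - star z)" if "z \<in> B" for z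
    using that BR by (auto intro!: R_closed simp: star_diff star_star)
  show "card {b \<in> B. star b = b} = 4"
  \<comment> \<open>Either \<open>b\<close> and \<open>star b\<close> are the only moved elements,
    leaving four fixed ones, or a second moved pair leads to a contradiction.\<close>
  proof (cases "B \<subseteq> F \<union> {b, star b}")
    case True
    then have eq: "B = F \<union> {b, star b}" using FB b sB by blast
    have "F \<inter> {b, star b} = {}" using b by (auto simp: F_def star_star)
    then have "card B = card F + card {b, star b}" using eq fin card_Un_disjoint[of F "{b, star b}"] by simp
    then show ?thesis using B b unfolding F_def by simp
  next
    case False
    then obtain c where c: "c \<in> B" "c \<notin> F" "c \<noteq> b" "c \<noteq> star b" by blast
    then have sc: "star c \<noteq> c" "star c \<noteq> b" "star c \<noteq> star b"
      by (auto simp: F_def star_star) (metis star_star)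
    define D where "D = {b, star b, c, star c}"
    have cD: "card D = 4" using b c sc by (auto simp: D_def)
    have DB: "D \<subseteq> B" using b c sB by (auto simp: D_def)
    have FD: "F \<inter> D = {}" using b c sc by (auto simp: F_def D_def star_star)
    have "B \<subseteq> F \<union> D"
    proof
      fix d assume d: "d \<in> B"
      show "d \<in> F \<union> D"
      proof (rule ccontr)
        assume nd: "d \<notin> F \<union> D"
        then have sd: "star d \<noteq> d" using d by (simp add: F_def)
        have "star d \<notin> D" using nd by (auto simp: D_def) (metis star_star)+
        moreover have "d \<notin> D" using nd by blast
        \<comment> \<open>A third moved pair would give six moved elements and, with the fixed
          \<open>1\<close>, seven elements of \<open>B\<close>.\<close>
        moreover have "1 \<notin> insert d (insert (star d) D)"
          using FD F1 sd nd star_1 star_star by (metis IntI UnI1 empty_iff insertE)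
        ultimately have "card (insert 1 (insert d (insert (star d) D))) = 7"
          using sd cD by (simp add: D_def)
        moreover have "insert 1 (insert d (insert (star d) D)) \<subseteq> B"
          using d sB DB one_B by blast
        then have "card (insert 1 (insert d (insert (star d) D))) \<le> card B"
          by (rule card_mono[OF B(1)])
        ultimately show False using B(4) by linarith
      qed
    qed
    then have eq: "B = F \<union> D" using FB DB by blast
    have "card F + 4 = 6" using eq FD fin cD B card_Un_disjoint[of F D] by (simp add: D_def)
    then have cF: "card F = 2" by simp
    let ?k = "\<lambda>b. b - star b" and ?h = "\<lambda>b. b + star b"
    have gen: "?k ` B \<subseteq> span {?k b, ?k c}"
    proof -
      have "?k b \<in> span {?k b, ?k c}" "?k c \<in> span {?k b, ?k c}" by (auto intro: span_base)
      moreover from this have "- ?k b \<in> span {?k b, ?k c}" "- ?k c \<in> span {?k b, ?k c}"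
        by (blast intro: span_neg)+
      ultimately show ?thesis unfolding eq D_def by (auto simp: F_def star_star span_zero)
    qed
    have skew: "l \<in> span {?k b, ?k c}" if "l \<in> R" "star l = - l" for l
      using skew_in_span[OF B(3) that] span_minimal[OF gen] by auto
    \<comment> \<open>\<open>b + star b\<close> is constant on \<open>star\<close>-orbits, so two
      fixed points and two pairs yield at most four generators of the symmetric part.\<close>
    have hB: "?h ` B = ?h ` F \<union> {?h b, ?h c}"
      unfolding eq D_def by (auto simp: star_star add.commute)
    have "card (?h ` B) \<le> card (?h ` F) + card {?h b, ?h c}"
      unfolding hB by (rule card_Un_le)
    moreover have "card (?h ` F) \<le> 2" using card_image_le[OF fin] cF by metis
    moreover have "card {?h b, ?h c} \<le> 2" by (simp add: card_insert_le_m1)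
    ultimately have cT: "card (?h ` B) \<le> 4" by linarith
    have indep: "?k c \<noteq> r \<cdot> ?k b" for r
    proof
      assume "?k c = r \<cdot> ?k b"
      then have "c = star c + r \<cdot> (b - star b)" by (simp add: algebra_simps)
      moreover have "star c \<in> span (B - {c})" "b \<in> span (B - {c})" "star b \<in> span (B - {c})"
        using b c sc sB by (auto intro!: span_base)
      ultimately have "c \<in> span (B - {c})" by (metis span_add span_scale span_diff)
      then show False using B(2) c(1) dependent_def by blast
    qed
    have "x * y = y * x"
      by (rule skew_plane_imp_commutative[of "?k b" "?k c" "?h ` B"])
        (use sk[OF b(1)] sk[OF c(1)] b indep skew symmetric_in_span[OF B(3)] cT nc B in auto)
    then show ?thesis using nc by simp
  qed
  then have "card F = 4" by (simp add: F_def)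
  have "F \<inter> {b, star b} = {}" using b by (auto simp: F_def star_star)
  then have "card (F \<union> {b, star b}) = 6"
    using fin b \<open>card F = 4\<close> by (simp add: card_Un_disjoint)
  then have eq: "B = F \<union> {b, star b}"
    using card_subset_eq[OF B(1), of "F \<union> {b, star b}"] FB b sB B(4) by auto
  have gen: "(\<lambda>b. b - star b) ` B \<subseteq> span {b - star b}"
  proof -
    have "b - star b \<in> span {b - star b}" by (auto intro: span_base)
    moreover from this have "- (b - star b) \<in> span {b - star b}" by (rule span_neg)
    ultimately show ?thesis by (subst eq) (auto simp: F_def star_star span_zero)
  qed
  have line: "l \<in> span {b - star b}" if "l \<in> R" "star l = - l" for l
    using skew_in_span[OF B(3) that] span_minimal[OF gen] by auto
  have "b - star b \<noteq> 0" using b by simp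
  from skew_line_imp_matrix_component[OF sk[OF b(1)] this line B nc]
  show "\<exists>\<psi>. bij_betw \<psi> UNIV R \<and> Vector_Spaces.linear scaleR scl \<psi> \<and> \<psi> RRM2_one = 1
      \<and> (\<forall>u v. \<psi> (RRM2_mult u v) = \<psi> u * \<psi> v)
      \<and> (\<forall>M. star (\<psi> (0, 0, M)) = \<psi> (0, 0, transpose M))"
    by metis
qed

end

section \<open>The real span of a reality-based algebra\<close>

context reality_based_algebra
begin

section \<open>Coefficients and the trace form\<close>

abbreviation coeff :: "'a \<Rightarrow> 'a \<Rightarrow> complex"
  where "coeff \<equiv> representation B"

lemma coeff_add: "coeff (x + y) b = coeff x b + coeff y b"
  using representation_add[OF independent_basis] span_basis by simp

lemma coeff_scale: "coeff (r *\<^sub>A x) b = r * coeff x b"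
  using representation_scale[OF independent_basis] span_basis by simp

lemma coeff_zero: "coeff 0 b = 0"
  by (simp add: representation_zero)

lemma coeff_basis: "b \<in> B \<Longrightarrow> coeff b c = (if c = b then 1 else 0)"
  using representation_basis[OF independent_basis] by simp

lemma coeff_sum_eq: "(\<Sum>b\<in>B. coeff x b *\<^sub>A b) = x"
  using sum_representation_eq[OF independent_basis _ finite_basis] span_basis by simp

lemma basis_induct [case_names zero step]:
  assumes "P 0" "\<And>r b x. b \<in> B \<Longrightarrow> P x \<Longrightarrow> P (r *\<^sub>A b + x)"
  shows "P x"
proof -
  have "x \<in> span B" by (simp add: span_basis)
  then show ?thesis by (induction rule: span_induct_alt) (auto intro: assms)
qed

lemma star_zero: "star 0 = 0"
  using star_scale[of 0 0] by simp

lemma star_one: "star 1 = 1"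
  by (metis mult.left_neutral mult.right_neutral star_mult star_star)

lemma star_in_basis: "b \<in> B \<Longrightarrow> star b \<in> B"
  using star_basis by blast

text \<open>\<open>star\<close> permutes \<open>B\<close> and fixes \<open>1\<close>, so it merely
  conjugates this coefficient.\<close>

lemma coeff_one_star: "coeff (star x) 1 = cnj (coeff x 1)"
proof (induction x rule: basis_induct)
  case zero then show ?case by (simp add: star_zero coeff_zero)
next
  case (step r b x)
  have "star b = 1 \<longleftrightarrow> b = 1" by (metis star_one star_star)
  then have "coeff (star b) 1 = cnj (coeff b 1)"
    using step star_in_basis by (simp add: coeff_basis)
  with step show ?case by (simp add: star_add star_scale coeff_add coeff_scale)
qed

text \<open>For basis elements both sides vanish unless \<open>star\<close> exchanges the two
  factors, where \<open>coeff_one_star_commute\<close> applies; the rest is bilinearity.\<close>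

lemma coeff_one_mult_commute: "coeff (x * y) 1 = coeff (y * x) 1"
proof (induction x rule: basis_induct)
  case (step r b x)
  have "coeff (b * y) 1 = coeff (y * b) 1"
  proof (induction y rule: basis_induct)
    case (step s c y)
    have "coeff (b * c) 1 = coeff (c * b) 1"
      using coeff_one_nonzero_iff[of b c] coeff_one_nonzero_iff[of c b]
        coeff_one_star_commute[of b] \<open>b \<in> B\<close> \<open>c \<in> B\<close> star_star by metis
    with step show ?case
      by (simp add: distrib_left distrib_right scale_mult_left scale_mult_right coeff_add coeff_scale)
  qed (simp add: coeff_zero)
  with step show ?case
    by (simp add: distrib_left distrib_right scale_mult_left scale_mult_right coeff_add coeff_scale)
qed (simp add: coeff_zero)

lemma coeff_one_mult_star_basis:
  assumes "b \<in> B"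
  shows "coeff (x * star b) 1 = coeff x b * coeff (b * star b) 1"
proof (induction x rule: basis_induct)
  case (step r c x)
  have "coeff (c * star b) 1 = coeff c b * coeff (b * star b) 1"
    using coeff_one_nonzero_iff[of c "star b"] assms \<open>c \<in> B\<close> star_in_basis star_star
    by (auto simp: coeff_basis) metis
  with step show ?case
    by (simp add: distrib_right scale_mult_left coeff_add coeff_scale algebra_simps)
qed (simp add: coeff_zero)

text \<open>\<open>B\<close> is orthogonal for this Hermitian form. The diagonal weights are
  positive, which yields definiteness next.\<close>

lemma coeff_one_mult_star:
  "coeff (x * star y) 1 = (\<Sum>b\<in>B. coeff x b * cnj (coeff y b) * coeff (b * star b) 1)"
proof (induction y rule: basis_induct)
  case (step r c y)
  have "(\<Sum>b\<in>B. coeff x b * cnj (coeff c b) * coeff (b * star b) 1)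
      = (\<Sum>b\<in>B. if b = c then coeff x b * coeff (b * star b) 1 else 0)"
    using \<open>c \<in> B\<close> by (intro sum.cong) (auto simp: coeff_basis)
  then have "coeff (x * star c) 1 = (\<Sum>b\<in>B. coeff x b * cnj (coeff c b) * coeff (b * star b) 1)"
    using finite_basis \<open>c \<in> B\<close> by (simp add: coeff_one_mult_star_basis[of c x])
  with step show ?case
    by (simp add: distrib_left star_add star_scale scale_mult_right coeff_add coeff_scale
        sum.distrib sum_distrib_left algebra_simps)
qed (simp add: coeff_zero star_zero)

lemma coeff_one_positive:
  assumes "x \<noteq> 0"
  shows "0 < Re (coeff (x * star x) 1)"
proof -
  have n: "0 < Re (coeff (b * star b) 1)" if "b \<in> B" for b
    using coeff_one_star_pos[OF that] by (simp add: less_complex_def)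
  have eq: "Re (coeff (x * star x) 1) = (\<Sum>b\<in>B. (cmod (coeff x b))\<^sup>2 * Re (coeff (b * star b) 1))"
    unfolding coeff_one_mult_star[of x x] Re_sum complex_norm_square[symmetric] by simp
  obtain c where "c \<in> B" "coeff x c \<noteq> 0"
    using assms coeff_sum_eq[of x] by (metis (no_types, lifting) scale_zero_left sum.neutral)
  then show ?thesis unfolding eq using n finite_basis
    by (intro sum_pos2[of _ c]) (auto intro!: mult_nonneg_nonneg less_imp_le[OF n])
qed

lemma coeff_one_definite: "coeff (x * star x) 1 = 0 \<Longrightarrow> x = 0"
  using coeff_one_positive[of x] by force

section \<open>The real span as a real algebra with involution\<close>

abbreviation R :: "'a set"
  where "R \<equiv> real_span smul B"

text \<open>Real structure constants keep products of basis elements in the real span; two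
  inductions extend this bilinearly.\<close>

lemma mult_in_R:
  assumes "x \<in> R" "y \<in> R"
  shows "x * y \<in> R"
proof -
  interpret real: vector_space "real_scale smul" by (rule vector_space_real_scale)
  have BB: "b * c \<in> R" if "b \<in> B" "c \<in> B" for b c
  proof -
    have "b * c = (\<Sum>d\<in>B. coeff (b * c) d *\<^sub>A d)" by (rule coeff_sum_eq[symmetric])
    also have "\<dots> = (\<Sum>d\<in>B. real_scale smul (Re (coeff (b * c) d)) d)"
      using structure_constants_real[OF that] by (intro sum.cong) (auto simp: real_scale_def)
    also have "\<dots> \<in> R" unfolding real_span_def
      by (intro real.span_sum real.span_scale real.span_base)
    finally show ?thesis .
  qed
  have Bx: "b * x \<in> R" if "b \<in> B" "x \<in> R" for b x
    using that(2) unfolding real_span_def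
  proof (induction rule: real.span_induct_alt)
    case (step r c x)
    have "b * (real_scale smul r c + x) = real_scale smul r (b * c) + b * x"
      by (simp add: real_scale_def distrib_left scale_mult_right)
    with step BB[OF that(1)] show ?case
      unfolding real_span_def by (simp add: real.span_add real.span_scale)
  qed (simp add: real.span_zero)
  show ?thesis using assms(1) unfolding real_span_def
  proof (induction rule: real.span_induct_alt)
    case (step r c x)
    have "(real_scale smul r c + x) * y = real_scale smul r (c * y) + x * y"
      by (simp add: real_scale_def distrib_right scale_mult_left)
    with step Bx[OF _ assms(2)] show ?case
      unfolding real_span_def by (simp add: real.span_add real.span_scale)
  qed (simp add: real.span_zero)
qed

lemma star_in_R:
  assumes "x \<in> R"
  shows "star x \<in> R"
proof -
  interpret real: vector_space "real_scale smul" by (rule vector_space_real_scale)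
  show ?thesis using assms unfolding real_span_def
  proof (induction rule: real.span_induct_alt)
    case (step r c x)
    have "star (real_scale smul r c + x) = real_scale smul r (star c) + star x"
      by (simp add: real_scale_def star_add star_scale)
    with step star_in_basis show ?case
      by (simp add: real.span_add real.span_scale real.span_base)
  qed (simp add: star_zero real.span_zero)
qed

lemma real_independent: "\<not> module.dependent (real_scale smul) B"
proof -
  interpret real: vector_space "real_scale smul" by (rule vector_space_real_scale)
  have "x \<in> span C" if "x \<in> real.span C" for x C
    using that
  proof (induction rule: real.span_induct_alt)
    case (step r c x)
    then show ?case by (simp add: real_scale_def span_add span_scale span_base)
  qed (simp add: span_zero)
  then show ?thesis using independent_basis unfolding dependent_def real.dependent_def by blast
qed

text \<open>\<open>B\<close> lies in \<open>R\<close> and spans \<open>A\<close> over the complex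
  numbers. The contrapositive passes noncommutativity from \<open>A\<close> to
  \<open>R\<close>.\<close>

lemma commutative_if_R_commutative:
  fixes x y :: 'a
  assumes "\<And>x y. \<lbrakk>x \<in> R; y \<in> R\<rbrakk> \<Longrightarrow> x * y = y * x"
  shows "x * y = y * x"
proof -
  interpret real: vector_space "real_scale smul" by (rule vector_space_real_scale)
  have BR: "b \<in> R" if "b \<in> B" for b using that unfolding real_span_def by (rule real.span_base)
  show ?thesis
  proof (induction x rule: basis_induct)
    case (step r b x)
    have "b * y = y * b"
    proof (induction y rule: basis_induct)
      case (step s c y)
      then show ?case using assms[OF BR BR] \<open>b \<in> B\<close>
        by (simp add: distrib_left distrib_right scale_mult_left scale_mult_right)
    qed simp
    with step show ?case
      by (simp add: distrib_left distrib_right scale_mult_left scale_mult_right)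
  qed simp
qed

text \<open>The idempotent of \<open>\<delta>\<close> is a multiple of the Riesz vector \<open>u\<close> that represents \<open>\<delta>\<close> with respect
  to the form \<open>coeff (x * star y) 1\<close>.\<close>

lemma degree_idempotent:
  assumes "positive_degree_map smul star B \<delta>"
  obtains e where "e \<in> R" "e \<noteq> 0" "e * e = e" "star e = e"
    "\<And>x. x * e = \<delta> x *\<^sub>A e" "\<And>x. e * x = \<delta> x *\<^sub>A e" "\<And>x. x \<in> R \<Longrightarrow> \<delta> x \<in> \<real>"
proof -
  interpret real: vector_space "real_scale smul" by (rule vector_space_real_scale)
  have lin: "\<delta> (x + y) = \<delta> x + \<delta> y" "\<delta> (r *\<^sub>A x) = r * \<delta> x"
    and \<delta>: "\<delta> 1 = 1" "\<delta> (x * y) = \<delta> x * \<delta> y" "\<delta> (star x) = cnj (\<delta> x)" for x y r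
    using assms unfolding positive_degree_map_def Vector_Spaces.linear_iff by auto
  have pos: "0 < \<delta> b" if "b \<in> B" for b
    using assms that unfolding positive_degree_map_def by auto
  have \<delta>0: "\<delta> 0 = 0" using lin(2)[of 0 0] by simp
  have \<delta>_sum: "\<delta> x = (\<Sum>b\<in>B. coeff x b * \<delta> b)" for x
  proof (induction x rule: basis_induct)
    case (step r c x)
    have "(\<Sum>b\<in>B. coeff c b * \<delta> b) = (\<Sum>b\<in>B. if b = c then \<delta> b else 0)"
      using \<open>c \<in> B\<close> by (intro sum.cong) (auto simp: coeff_basis)
    then have "\<delta> c = (\<Sum>b\<in>B. coeff c b * \<delta> b)" using \<open>c \<in> B\<close> finite_basis by simp
    then show ?case using step
      by (simp add: lin coeff_add coeff_scale sum.distrib sum_distrib_left algebra_simps)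
  qed (simp add: \<delta>0 coeff_zero)
  \<comment> \<open>These Riesz coefficients make \<open>w b\<close> times the squared length of
    \<open>b\<close> equal to \<open>\<delta> b\<close>. Both numbers are positive reals, so taking
    real parts loses nothing and puts \<open>u\<close> in \<open>R\<close>.\<close>
  define w where "w b = Re (\<delta> b) / Re (coeff (b * star b) 1)" for b
  define u where "u = (\<Sum>b\<in>B. real_scale smul (w b) b)"
  have uR: "u \<in> R" unfolding u_def real_span_def
    by (intro real.span_sum real.span_scale real.span_base)
  have w: "complex_of_real (w b) * coeff (b * star b) 1 = \<delta> b" if "b \<in> B" for b
    using pos[OF that] coeff_one_star_pos[OF that]
    by (auto simp: w_def less_complex_def complex_eq_iff)
  have coeff_u: "coeff u b = w b" if "b \<in> B" for b
  proof -
    have "coeff u b = (\<Sum>c\<in>B. coeff (real_scale smul (w c) c) b)"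
      unfolding u_def by (subst representation_sum[OF independent_basis]) (simp_all add: span_basis)
    also have "\<dots> = (\<Sum>c\<in>B. if c = b then complex_of_real (w c) else 0)"
      using that by (intro sum.cong) (auto simp: real_scale_def coeff_scale coeff_basis)
    also have "\<dots> = w b" using that finite_basis by simp
    finally show ?thesis .
  qed
  have form: "coeff (x * star u) 1 = \<delta> x" for x
    unfolding coeff_one_mult_star[of x u] \<delta>_sum[of x]
    by (intro sum.cong refl) (simp add: coeff_u w mult.assoc)
  have eqI: "y = z" if "\<And>x. coeff (x * star y) 1 = coeff (x * star z) 1" for y z
  proof -
    have "star (y - z) = star y - star z"
      using star_add[of "y - z" z] by simp
    then have "coeff ((y - z) * star y) 1 = coeff ((y - z) * star (y - z)) 1 + coeff ((y - z) * star z) 1"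
      by (simp add: right_diff_distrib flip: coeff_add)
    then have "coeff ((y - z) * star (y - z)) 1 = 0" using that by simp
    then show ?thesis using coeff_one_definite by force
  qed
  have mult_u: "z * u = \<delta> z *\<^sub>A u" for z
  proof (rule eqI)
    fix x
    \<comment> \<open>Cyclicity brings \<open>star z\<close> to the front, so \<open>form\<close>
      evaluates the right side as \<open>\<delta> (star z * x)\<close>.\<close>
    have "coeff (x * star (z * u)) 1 = coeff (star z * x * star u) 1"
      unfolding star_mult by (metis coeff_one_mult_commute mult.assoc)
    then show "coeff (x * star (z * u)) 1 = coeff (x * star (\<delta> z *\<^sub>A u)) 1"
      by (simp add: form \<delta> star_scale scale_mult_right coeff_scale)
  qed
  have u_mult: "u * z = \<delta> z *\<^sub>A u" for z
  proof (rule eqI)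
    fix x
    show "coeff (x * star (u * z)) 1 = coeff (x * star (\<delta> z *\<^sub>A u)) 1"
      using form[of "x * star z"]
      by (simp add: form \<delta> star_mult star_scale scale_mult_right coeff_scale mult.assoc)
  qed
  have star_u: "star u = u"
  proof (rule eqI)
    fix x
    have "coeff (x * star (star u)) 1 = cnj (coeff (star u * star x) 1)"
      by (metis coeff_one_star star_mult star_star)
    also have "\<dots> = \<delta> x"
      using form[of "star x"] by (simp add: coeff_one_mult_commute[of "star u"] \<delta>)
    finally show "coeff (x * star (star u)) 1 = coeff (x * star u) 1" by (simp add: form)
  qed
  have "u \<noteq> 0" using form[of 1] by (auto simp: star_zero coeff_zero \<delta>)
  have \<delta>u: "\<delta> u \<noteq> 0" using form[of u] \<open>u \<noteq> 0\<close> coeff_one_definite by metis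
  have \<delta>R: "\<delta> x \<in> \<real>" if "x \<in> R" for x
    using that unfolding real_span_def
  proof (induction rule: real.span_induct_alt)
    case (step r c x)
    have "\<delta> c \<in> \<real>" using pos[OF step(1)] by (simp add: complex_is_Real_iff less_complex_def)
    with step show ?case by (simp add: lin real_scale_def)
  qed (simp add: \<delta>0)
  \<comment> \<open>\<open>\<delta> u\<close> is the squared length of \<open>u\<close>, real and
    nonzero. Dividing by it gives \<open>\<delta> e = 1\<close>, which makes \<open>e\<close>
    idempotent.\<close>
  define e where "e = real_scale smul (1 / Re (\<delta> u)) u"
  have e_eq: "e = (1 / \<delta> u) *\<^sub>A u"
    using \<delta>R[OF uR] by (auto simp: e_def real_scale_def elim!: Reals_cases)
  have xe: "x * e = \<delta> x *\<^sub>A e" and ex: "e * x = \<delta> x *\<^sub>A e" for x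
    unfolding e_eq by (simp_all add: scale_mult_left scale_mult_right mult_u u_mult mult.commute)
  have "\<delta> e = 1" unfolding e_eq using \<delta>u by (simp add: lin)
  show ?thesis
  proof (rule that[of e])
    show "e \<in> R" using uR unfolding e_def real_span_def by (rule real.span_scale)
    show "e \<noteq> 0" using \<open>\<delta> e = 1\<close> \<delta>0 by auto
    show "e * e = e" using xe[of e] \<open>\<delta> e = 1\<close> by simp
    show "star e = e" unfolding e_def by (simp add: real_scale_def star_scale star_u)
  qed (use xe ex \<delta>R in auto)
qed

end

section \<open>Descent from the complex algebra to its real span\<close>

theorem lemma1:
  fixes smul :: "complex \<Rightarrow> 'a::ring_1 \<Rightarrow> 'a"
    and star :: "'a \<Rightarrow> 'a"
    and B :: "'a set"
    and \<delta> :: "'a \<Rightarrow> complex"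
  assumes "reality_based_algebra smul star B"
    and "card B = 6"
    and "\<not> (\<forall>x y :: 'a. x * y = y * x)"
    and "positive_degree_map smul star B \<delta>"
  shows "(\<exists>\<psi>. RRM2_iso smul (real_span smul B) \<psi> \<and>
            (\<forall>M. star (\<psi> (0, 0, M)) = \<psi> (0, 0, transpose M))) \<and>
         card {b \<in> B. star b = b} = 4"
proof -
  interpret reality_based_algebra smul star B by fact
  interpret real: vector_space "real_scale smul" by (rule vector_space_real_scale)
  obtain e where e: "e \<in> R" "e \<noteq> 0" "e * e = e" "star e = e"
    "\<And>x. x * e = smul (\<delta> x) e" "\<And>x. e * x = smul (\<delta> x) e" "\<And>x. x \<in> R \<Longrightarrow> \<delta> x \<in> \<real>"
    using degree_idempotent[OF assms(4)] by blast
  interpret A: positive_involution_algebra "real_scale smul" star "\<lambda>x. Re (coeff x 1)" R e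
  proof unfold_locales
    show "1 \<in> R" unfolding real_span_def by (rule real.span_base) (rule one_in_basis)
    show "real.subspace R" unfolding real_span_def by (rule real.subspace_span)
    fix x y :: 'a and r :: real
    show "Re (coeff (x * y) 1) = Re (coeff (y * x) 1)" by (simp only: coeff_one_mult_commute)
    show "\<exists>r. x * e = real_scale smul r e" if "x \<in> R"
      using e(7)[OF that] unfolding e(5) real_scale_def by (metis Reals_cases)
    show "x * e = e * x" by (simp only: e)
  qed (use e in \<open>simp_all add: real_scale_def scale_mult_left scale_mult_right star_add star_scale
      star_mult star_star coeff_add coeff_scale coeff_one_positive mult_in_R star_in_R\<close>)
  obtain x y where xy: "x \<in> R" "y \<in> R" "x * y \<noteq> y * x"
    using commutative_if_R_commutative assms(3) by blast
  note main = A.rank_6_noncommutative[OF finite_basis real_independent real_span_def assms(2)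
      star_basis one_in_basis xy]
  show ?thesis using main unfolding RRM2_iso_def by simp
qed

end
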